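(* Let $P$ be a poset such that $A'=\operatorname{cl}_\sigma(A)$ for every subset $A\subseteq P$ (i.e. $P$ has one-step closure). Then $P$ is meet-continuous: for any $x\in P$ and any directed subset $D\subseteq P$ such that $\bigvee D$ exists and $x\le\bigvee D$, one has $x\in\operatorname{cl}_\sigma(\mathord{\downarrow}D\cap\mathord{\downarrow}x)$.
   Context: $\mathord{\downarrow}X=\{z\mid \exists y\in X,\ z\le y\}$, $\mathord{\downarrow}x=\mathord{\downarrow}\{x\}$. A subset is directed if nonempty and every finite subset has an upper bound in it. For $A\subseteq P$, $A'=\{x\in P\mid x=\bigvee D \text{ for some directed } D\subseteq\mathord{\downarrow}A\}$. A set $U$ is Scott open if it is an upper set and whenever $D$ is directed with $\bigvee D$ existing and in $U$, then $D\cap U\ne\emptyset$; $\operatorname{cl}_\sigma$ is closure in the Scott topology. *)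

theory Defs
  imports "HOL-Analysis.Abstract_Topology" "HOL-Library.Lub_Glb"
begin

text \<open>
  A poset is a type of class \<open>order\<close>. In this setting \<open>isLub UNIV D x\<close> says that the
  supremum of \<open>D\<close> exists and equals \<open>x\<close>, and the principal ideal of \<open>x\<close> is \<open>{..x}\<close>.
\<close>

definition down :: "'a::order set \<Rightarrow> 'a set" where
  "down X = {z. \<exists>y\<in>X. z \<le> y}"

definition directed :: "'a::order set \<Rightarrow> bool" where
  "directed D \<longleftrightarrow> D \<noteq> {} \<and> (\<forall>F. finite F \<and> F \<subseteq> D \<longrightarrow> (\<exists>u\<in>D. \<forall>y\<in>F. y \<le> u))"

definition one_step :: "'a::order set \<Rightarrow> 'a set" where
  "one_step A = {x. \<exists>D. directed D \<and> D \<subseteq> down A \<and> isLub UNIV D x}"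

definition scott_open :: "'a::order set \<Rightarrow> bool" where
  "scott_open U \<longleftrightarrow>
     (\<forall>x\<in>U. \<forall>y. x \<le> y \<longrightarrow> y \<in> U) \<and>
     (\<forall>D s. directed D \<and> isLub UNIV D s \<and> s \<in> U \<longrightarrow> D \<inter> U \<noteq> {})"

definition scott_topology :: "'a::order topology" where
  "scott_topology = topology scott_open"

lemma down_singleton: "down {x} = {..x}"
  by (auto simp: down_def)

lemma scott_openI:
  assumes "\<And>x y. x \<in> U \<Longrightarrow> x \<le> y \<Longrightarrow> y \<in> U"
    and "\<And>D s. directed D \<Longrightarrow> isLub UNIV D s \<Longrightarrow> s \<in> U \<Longrightarrow> \<exists>d\<in>D. d \<in> U"
  shows "scott_open U"
  unfolding scott_open_def
proof (intro conjI ballI allI impI)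
  show "y \<in> U" if "x \<in> U" "x \<le> y" for x y
    using that by (rule assms(1))
  show "D \<inter> U \<noteq> {}" if "directed D \<and> isLub UNIV D s \<and> s \<in> U" for D s
    using assms(2)[of D s] that by auto
qed

lemma scott_open_upper: "scott_open U \<Longrightarrow> x \<in> U \<Longrightarrow> x \<le> y \<Longrightarrow> y \<in> U"
  by (simp add: scott_open_def)

lemma scott_open_directed:
  assumes "scott_open U" "directed D" "isLub UNIV D s" "s \<in> U"
  obtains d where "d \<in> D" "d \<in> U"
proof -
  have "D \<inter> U \<noteq> {}"
    using assms unfolding scott_open_def by metis
  with that show thesis by auto
qed

lemma directed_finite_bound:
  assumes "directed D" "finite F" "F \<subseteq> D"
  shows "\<exists>u\<in>D. \<forall>y\<in>F. y \<le> u"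
  using assms by (simp add: directed_def)

lemma istopology_scott_open: "istopology (scott_open :: 'a::order set \<Rightarrow> bool)"
  unfolding istopology_def
proof (intro conjI allI impI)
  fix U V :: "'a set"
  assume U: "scott_open U" and V: "scott_open V"
  show "scott_open (U \<inter> V)"
  proof (rule scott_openI)
    show "y \<in> U \<inter> V" if "x \<in> U \<inter> V" "x \<le> y" for x y
      using that scott_open_upper[OF U] scott_open_upper[OF V] by auto
  next
    fix D s
    assume D: "directed D" "isLub UNIV D s" "s \<in> U \<inter> V"
    obtain a where a: "a \<in> D" "a \<in> U"
      using scott_open_directed[OF U D(1,2)] D(3) by auto
    obtain b where b: "b \<in> D" "b \<in> V"
      using scott_open_directed[OF V D(1,2)] D(3) by auto
    have "\<exists>c\<in>D. \<forall>y\<in>{a, b}. y \<le> c"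
      by (rule directed_finite_bound[OF D(1)]) (simp_all add: a(1) b(1))
    then obtain c where "c \<in> D" "a \<le> c" "b \<le> c" by auto
    then show "\<exists>d\<in>D. d \<in> U \<inter> V"
      using scott_open_upper[OF U a(2)] scott_open_upper[OF V b(2)] by auto
  qed
next
  fix \<K> :: "'a set set"
  assume K: "\<forall>U\<in>\<K>. scott_open U"
  show "scott_open (\<Union>\<K>)"
  proof (rule scott_openI)
    show "y \<in> \<Union>\<K>" if "x \<in> \<Union>\<K>" "x \<le> y" for x y
      using that K by (meson UnionE UnionI scott_open_upper)
  next
    fix D s
    assume D: "directed D" "isLub UNIV D s" "s \<in> \<Union>\<K>"
    then obtain U where U: "U \<in> \<K>" "s \<in> U" by auto
    obtain d where "d \<in> D" "d \<in> U"
      using scott_open_directed[OF _ D(1,2) U(2)] K U(1) by auto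
    then show "\<exists>d\<in>D. d \<in> \<Union>\<K>" using U(1) by auto
  qed
qed

lemma openin_scott_topology: "openin scott_topology U \<longleftrightarrow> scott_open U"
  by (simp add: scott_topology_def istopology_scott_open topology_inverse')

lemma topspace_scott_topology: "topspace scott_topology = (UNIV :: 'a::order set)"
proof -
  have "scott_open (UNIV :: 'a set)"
    by (rule scott_openI) (auto simp: directed_def)
  then have "openin scott_topology (UNIV :: 'a set)"
    by (simp only: openin_scott_topology)
  then show ?thesis
    using openin_subset by auto
qed

text \<open>
  The following two properties belong to the poset, that is, to the type; the poset is
  passed as a type token.
\<close>

definition one_step_closure :: "'a::order itself \<Rightarrow> bool" where
  "one_step_closure _ \<longleftrightarrow> (\<forall>A :: 'a set. one_step A = scott_topology closure_of A)"

definition meet_continuous :: "'a::order itself \<Rightarrow> bool" where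
  "meet_continuous _ \<longleftrightarrow>
     (\<forall>(x :: 'a) D s. directed D \<and> isLub UNIV D s \<and> x \<le> s \<longrightarrow>
        x \<in> scott_topology closure_of (down D \<inter> down {x}))"

end

(* Since one_step D is Scott closed, it is a lower set. It contains the supremum of D and therefore
   x, so x is the supremum of a directed E contained in down D; and E lies below its own supremum x. *)
theory Submission
  imports Defs
begin

lemma subset_down: "A \<subseteq> down A"
  by (auto simp: down_def)

text \<open>A Scott open neighbourhood of \<open>x\<close> is an upper set, so it also contains
  \<open>s\<close> and therefore meets \<open>A\<close>.\<close>

lemma scott_closure_downward:
  assumes "s \<in> scott_topology closure_of A" "x \<le> s"
  shows "x \<in> scott_topology closure_of A"
  using assms scott_open_upper
  unfolding in_closure_of topspace_scott_topology openin_scott_topology by blast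

theorem theorem5p8:
  assumes "one_step_closure TYPE('a::order)"
  shows "meet_continuous TYPE('a)"
  unfolding meet_continuous_def
proof (intro allI impI)
  fix x s :: 'a and D
  assume D: "directed D \<and> isLub UNIV D s \<and> x \<le> s"
  \<comment> \<open>Kept general in \<open>A\<close> because it serves two sets: first
    \<open>D\<close>, and at the end \<open>down D \<inter> down {x}\<close>.\<close>
  have closure: "one_step A = scott_topology closure_of A" for A :: "'a set"
    using assms by (simp add: one_step_closure_def)
  have "s \<in> one_step D"
    using D subset_down unfolding one_step_def by blast
  then have "x \<in> one_step D"
    using D scott_closure_downward unfolding closure by blast
  then obtain E where E: "directed E" "E \<subseteq> down D" "isLub UNIV E x"
    unfolding one_step_def by blast
  have "E \<subseteq> down {x}"
    using isLubD2[OF E(3)] by (auto simp: down_singleton)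
  then have "E \<subseteq> down (down D \<inter> down {x})"
    using E(2) subset_down by blast
  \<comment> \<open>The witness is again \<open>E\<close>: its supremum is still \<open>x\<close>,
    and only the set whose down-closure contains it has shrunk.\<close>
  then have "x \<in> one_step (down D \<inter> down {x})"
    using E unfolding one_step_def by blast
  then show "x \<in> scott_topology closure_of (down D \<inter> down {x})"
    by (simp only: closure)
qed

end
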